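(* The K-shell protocol (written out in the context) for computing the K-shell decomposition uses $$\mathcal{O}\left((n+m)\log^2(n)\right)$$ primitive operations, assuming the ORAM accesses are performed using the Circuit ORAM construction.
   Context: **Graphs and representation.** $G(V,E)$ is a graph with vertex set $V=\{1,\dots,n\}$ and $m=|E|$ edges; edges are directed (ordered pairs of vertices), an undirected graph being included as a graph with bidirectional edges. The input is given in the edgelist representation $(\mathcal{E},Idx)$. $\mathcal{E}$ is an array of length $m+1$ containing the concatenated adjacency lists of all vertices (in the order $1,2,\dots,n$) and an empty element at the end. $Idx$ is an array of length $n$: $Idx[u]=i$ if out-degree$(u)\neq 0$ and $\mathcal{E}[i]$ is the first neighbour of $u$ in $\mathcal{E}$; $Idx[u]=Idx[u+1]$ if $u\neq n$ and out-degree$(u)=0$; $Idx[u]=m+1$ if $u=n$ and out-degree$(u)=0$. Convention: $Idx[n+1]=m+1$. **Cost model.** Efficiency is measured by the number of primitive operations; addition, subtraction, multiplication, division, comparison and equality check are primitive operations. The arrays $deg,bin,vert,pos,\mathcal{E},Idx$ are stored in an Oblivious RAM (ORAM), which allows array accesses at secret indices. With the Circuit ORAM construction each block access to an ORAM array of size $N$ is performed in $\mathcal{O}(\log^2 N)$ operations. The if-else construct is executed by running both branches one after the other, one of them in a dummy fashion. Oblivious sorting of $n$ elements is assumed to cost $\mathcal{O}(n(\log (n))^2)$. **The K-shell protocol.** Input: $(\mathcal{E},Idx)$. Output: the shell number of each $v\in V$ (the $i$ such that $v$ is in the $i$-core but not in the $(i+1)$-core, the $k$-core being the subgraph induced by the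 largest vertex set in which every vertex has degree at least $k$ within that subgraph), namely the final value $deg[v]$. 1. $deg[i]\leftarrow 0$ for $1\le i\le n$; $vert[i]\leftarrow i$ for $1\le i\le n$; $bin[i]\leftarrow 0$ for $1\le i\le n-1$. 2. For $i=1$ to $n$: $deg[i]\leftarrow Idx[i+1]-Idx[i]$; $bin[deg[i]]\leftarrow bin[deg[i]]+1$. 3. $start\leftarrow 1$. For $i=1$ to $n$: $temp\leftarrow bin[i]$; $bin[i]\leftarrow start$; $start\leftarrow start+temp$. 4. Sort $vert$ with respect to the degrees $deg$ (by the oblivious sorting primitive). Set $pos[vert[i]]\leftarrow i$ for $1\le i\le n$. 5. $i\leftarrow 1$; $v\leftarrow vert[i]$; $j\leftarrow Idx[v]$. 6. For $iter=1$ to $n+m-1$: - If $j==Idx[v+1]$: $i\leftarrow i+1$; $v\leftarrow vert[i]$; $j\leftarrow Idx[v]$. - Else: $u\leftarrow\mathcal{E}[j]$. If $deg[u]>deg[v]$: { $du\leftarrow deg[u]$; $pu\leftarrow pos[u]$; $pw\leftarrow bin[du]$; $w\leftarrow vert[pw]$; if $u\neq w$: { $pos[u]\leftarrow pw$; $vert[pu]\leftarrow w$; $pos[w]\leftarrow pu$; $vert[pw]\leftarrow u$ }; $bin[du]\leftarrow bin[du]+1$; $deg[u]\leftarrow deg[u]-1$ }. Then (still in the else branch) $j\leftarrow j+1$. *)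

theory Defs
  imports Complex_Main "HOL-Library.Multiset" "HOL-Library.Landau_Symbols"
begin

text \<open>
  Arrays are 1-based, as in the pseudocode: the list of neighbours occupies positions \<open>1..|E|\<close>
  of \<open>edges\<close>, and position \<open>|E| + 1\<close> is the empty element, whose content is unconstrained.
  The graph has no parallel edges; the order within each adjacency list is arbitrary.
\<close>

definition edgelist_rep :: "nat \<Rightarrow> (nat \<times> nat) set \<Rightarrow> (nat \<Rightarrow> nat) \<Rightarrow> (nat \<Rightarrow> nat) \<Rightarrow> bool" where
  "edgelist_rep n E edges idx \<longleftrightarrow>
     E \<subseteq> {1..n} \<times> {1..n} \<and>
     (\<exists>adj :: nat \<Rightarrow> nat list.
        (\<forall>u\<in>{1..n}. distinct (adj u) \<and> set (adj u) = {v. (u, v) \<in> E}) \<and>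
        map edges [1..<card E + 1] = concat (map adj [1..<n + 1]) \<and>
        (\<forall>u\<in>{1..n}. idx u =
           (if adj u \<noteq> [] then 1 + (\<Sum>w = 1..<u. length (adj w))
            else if u \<noteq> n then idx (u + 1)
            else card E + 1)) \<and>
        idx (n + 1) = card E + 1)"

datatype arr = Deg | Bin | Vert | Pos | Edges | Idx

datatype svar = Vi | Vj | Vv | Vu | Vw | Vdu | Vpu | Vpw | Vstart | Vtemp | Viter

datatype aexp = Num nat | Var svar | Get arr aexp | Add aexp aexp | Sub aexp aexp

datatype bexp = Eq aexp aexp | Neq aexp aexp | Gt aexp aexp

datatype com =
    Skip
  | Assign svar aexp  (infix \<open>::=\<close> 61)
  | Put arr aexp aexp
  | Seq com com  (infixr \<open>;;\<close> 60)
  | IfElse bexp com com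
  | For svar nat nat com
  | SortBy arr arr

record state =
  scal :: "svar \<Rightarrow> nat"
  heap :: "arr \<Rightarrow> nat \<Rightarrow> nat"

text \<open>
  \<open>oram_ops M N\<close> is the number of operations of one access to an ORAM array with \<open>N\<close> cells;
  \<open>sort_ops M N\<close> that of obliviously sorting \<open>N\<close> elements. \<open>sort_by M\<close> is the result of the
  sorting primitive; it is a parameter because the order of elements with equal keys is not
  prescribed.
\<close>

record oblivious_machine =
  oram_ops :: "nat \<Rightarrow> nat"
  sort_ops :: "nat \<Rightarrow> nat"
  sort_by :: "(nat \<Rightarrow> nat) \<Rightarrow> nat list \<Rightarrow> nat list"

definition sorting_function :: "((nat \<Rightarrow> nat) \<Rightarrow> nat list \<Rightarrow> nat list) \<Rightarrow> bool" where
  "sorting_function f \<longleftrightarrow>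
     (\<forall>key xs. mset (f key xs) = mset xs \<and> sorted (map key (f key xs)))"

primrec aval :: "aexp \<Rightarrow> state \<Rightarrow> nat" where
  "aval (Num k) s = k"
| "aval (Var x) s = scal s x"
| "aval (Get a e) s = heap s a (aval e s)"
| "aval (Add e1 e2) s = aval e1 s + aval e2 s"
| "aval (Sub e1 e2) s = aval e1 s - aval e2 s"

primrec bval :: "bexp \<Rightarrow> state \<Rightarrow> bool" where
  "bval (Eq e1 e2) s \<longleftrightarrow> aval e1 s = aval e2 s"
| "bval (Neq e1 e2) s \<longleftrightarrow> aval e1 s \<noteq> aval e2 s"
| "bval (Gt e1 e2) s \<longleftrightarrow> aval e1 s > aval e2 s"

text \<open>Below, \<open>sz\<close> gives the number of cells of each array.\<close>

primrec aops :: "oblivious_machine \<Rightarrow> (arr \<Rightarrow> nat) \<Rightarrow> aexp \<Rightarrow> nat" where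
  "aops M sz (Num k) = 0"
| "aops M sz (Var x) = 0"
| "aops M sz (Get a e) = aops M sz e + oram_ops M (sz a)"
| "aops M sz (Add e1 e2) = aops M sz e1 + aops M sz e2 + 1"
| "aops M sz (Sub e1 e2) = aops M sz e1 + aops M sz e2 + 1"

primrec bops :: "oblivious_machine \<Rightarrow> (arr \<Rightarrow> nat) \<Rightarrow> bexp \<Rightarrow> nat" where
  "bops M sz (Eq e1 e2) = aops M sz e1 + aops M sz e2 + 1"
| "bops M sz (Neq e1 e2) = aops M sz e1 + aops M sz e2 + 1"
| "bops M sz (Gt e1 e2) = aops M sz e1 + aops M sz e2 + 1"

text \<open>
  \<open>exec M sz c s\<close> is the final state together with the number of operations performed.
  A conditional runs both branches and is charged for both; the effect of the dummy one is
  discarded. Scalar assignments are charged one operation each, so the count can only exceed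
  the number of arithmetic operations, comparisons and ORAM operations. A loop is charged as
  \<open>x := a; while x \<le> b do (c; x := x + 1)\<close>.
\<close>

primrec exec :: "oblivious_machine \<Rightarrow> (arr \<Rightarrow> nat) \<Rightarrow> com \<Rightarrow> state \<Rightarrow> state \<times> nat" where
  "exec M sz Skip s = (s, 0)"
| "exec M sz (x ::= e) s = (s\<lparr>scal := (scal s)(x := aval e s)\<rparr>, aops M sz e + 1)"
| "exec M sz (Put a e1 e2) s =
     (s\<lparr>heap := (heap s)(a := (heap s a)(aval e1 s := aval e2 s))\<rparr>,
      aops M sz e1 + aops M sz e2 + oram_ops M (sz a))"
| "exec M sz (c1 ;; c2) s =
     (let (s1, k1) = exec M sz c1 s;
          (s2, k2) = exec M sz c2 s1
      in (s2, k1 + k2))"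
| "exec M sz (IfElse b c1 c2) s =
     (let (s1, k1) = exec M sz c1 s;
          (s2, k2) = exec M sz c2 s
      in (if bval b s then s1 else s2, bops M sz b + k1 + k2))"
| "exec M sz (For x a b c) s =
     fold (\<lambda>i (s, k). let (s', k') = exec M sz c (s\<lparr>scal := (scal s)(x := i)\<rparr>)
                      in (s', k + k' + 3))
       [a..<b + 1] (s, 2)"
| "exec M sz (SortBy a key) s =
     (let xs = sort_by M (heap s key) (map (heap s a) [1..<sz a + 1])
      in (s\<lparr>heap := (heap s)(a := (\<lambda>i. if i \<in> {1..sz a} then xs ! (i - 1) else heap s a i))\<rparr>,
          sort_ops M (sz a)))"

text \<open>
  \<open>Bin\<close> is indexed by degrees, hence by \<open>0..n\<close>; \<open>Idx\<close> includes the conventional entry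
  \<open>n + 1\<close>, which is read when \<open>v = n\<close>.
\<close>

fun kshell_size :: "nat \<Rightarrow> nat \<Rightarrow> arr \<Rightarrow> nat" where
  "kshell_size n m Deg = n"
| "kshell_size n m Vert = n"
| "kshell_size n m Pos = n"
| "kshell_size n m Bin = n + 1"
| "kshell_size n m Idx = n + 1"
| "kshell_size n m Edges = m + 1"

definition kshell_init :: "nat \<Rightarrow> com" where
  "kshell_init n =
     For Vi 1 n (Put Deg (Var Vi) (Num 0)) ;;
     For Vi 1 n (Put Vert (Var Vi) (Var Vi)) ;;
     For Vi 1 (n - 1) (Put Bin (Var Vi) (Num 0))"

definition kshell_degrees :: "nat \<Rightarrow> com" where
  "kshell_degrees n =
     For Vi 1 n
       (Put Deg (Var Vi) (Sub (Get Idx (Add (Var Vi) (Num 1))) (Get Idx (Var Vi))) ;;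
        Put Bin (Get Deg (Var Vi)) (Add (Get Bin (Get Deg (Var Vi))) (Num 1)))"

definition kshell_bins :: "nat \<Rightarrow> com" where
  "kshell_bins n =
     Vstart ::= Num 1 ;;
     For Vi 1 n
       (Vtemp ::= Get Bin (Var Vi) ;;
        Put Bin (Var Vi) (Var Vstart) ;;
        Vstart ::= Add (Var Vstart) (Var Vtemp))"

definition kshell_sort :: "nat \<Rightarrow> com" where
  "kshell_sort n =
     SortBy Vert Deg ;;
     For Vi 1 n (Put Pos (Get Vert (Var Vi)) (Var Vi))"

definition kshell_step :: com where
  "kshell_step =
     IfElse (Eq (Var Vj) (Get Idx (Add (Var Vv) (Num 1))))
       (Vi ::= Add (Var Vi) (Num 1) ;;
        Vv ::= Get Vert (Var Vi) ;;
        Vj ::= Get Idx (Var Vv))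
       (Vu ::= Get Edges (Var Vj) ;;
        IfElse (Gt (Get Deg (Var Vu)) (Get Deg (Var Vv)))
          (Vdu ::= Get Deg (Var Vu) ;;
           Vpu ::= Get Pos (Var Vu) ;;
           Vpw ::= Get Bin (Var Vdu) ;;
           Vw ::= Get Vert (Var Vpw) ;;
           IfElse (Neq (Var Vu) (Var Vw))
             (Put Pos (Var Vu) (Var Vpw) ;;
              Put Vert (Var Vpu) (Var Vw) ;;
              Put Pos (Var Vw) (Var Vpu) ;;
              Put Vert (Var Vpw) (Var Vu))
             Skip ;;
           Put Bin (Var Vdu) (Add (Get Bin (Var Vdu)) (Num 1)) ;;
           Put Deg (Var Vu) (Sub (Get Deg (Var Vu)) (Num 1)))
          Skip ;;
        Vj ::= Add (Var Vj) (Num 1))"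

definition kshell :: "nat \<Rightarrow> nat \<Rightarrow> com" where
  "kshell n m =
     kshell_init n ;;
     kshell_degrees n ;;
     kshell_bins n ;;
     kshell_sort n ;;
     Vi ::= Num 1 ;;
     Vv ::= Get Vert (Var Vi) ;;
     Vj ::= Get Idx (Var Vv) ;;
     For Viter 1 (n + m - 1) kshell_step"

definition kshell_ops :: "oblivious_machine \<Rightarrow> nat \<Rightarrow> nat \<Rightarrow> state \<Rightarrow> nat" where
  "kshell_ops M n m s = snd (exec M (kshell_size n m) (kshell n m) s)"

end

theory Submission
  imports Defs
begin

text \<open>
  Both branches of every conditional are executed and all loop bounds are fixed, so the number of
  operations does not depend on the data: it is a function of the program text alone. Apart from
  one sorting call, the protocol consists of six loops with at most \<open>n\<close> iterations and one with
  \<open>n + m - 1\<close>, and each loop body makes a bounded number of ORAM accesses. Without parallel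
  edges \<open>m \<le> n\<^sup>2\<close>, so even an access to the edge array costs \<open>O(log\<^sup>2 n)\<close>.
\<close>

text \<open>The counter of \<open>exec\<close> with the state removed. \<open>b + 1 - a\<close> is
  the length of \<open>[a..<b + 1]\<close>; truncation makes it 0 on an empty range.\<close>

primrec com_ops :: "oblivious_machine \<Rightarrow> (arr \<Rightarrow> nat) \<Rightarrow> com \<Rightarrow> nat" where
  "com_ops M sz Skip = 0"
| "com_ops M sz (x ::= e) = aops M sz e + 1"
| "com_ops M sz (Put a e1 e2) = aops M sz e1 + aops M sz e2 + oram_ops M (sz a)"
| "com_ops M sz (c1 ;; c2) = com_ops M sz c1 + com_ops M sz c2"
| "com_ops M sz (IfElse b c1 c2) = bops M sz b + com_ops M sz c1 + com_ops M sz c2"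
| "com_ops M sz (For x a b c) = 2 + (b + 1 - a) * (com_ops M sz c + 3)"
| "com_ops M sz (SortBy a key) = sort_ops M (sz a)"

lemma snd_exec: "snd (exec M sz c s) = com_ops M sz c"
proof (induction c arbitrary: s)
  case (For x a b c)
  let ?f = "\<lambda>i (s, k). let (s', k') = exec M sz c (s\<lparr>scal := (scal s)(x := i)\<rparr>)
                        in (s', k + k' + 3)"
  \<comment> \<open>The fold threads both state and counter, so both must be arbitrary in the
    induction.\<close>
  have "snd (fold ?f xs (s, k)) = k + length xs * (com_ops M sz c + 3)" for xs s k
  proof (induction xs arbitrary: s k)
    case (Cons i xs)
    then show ?case
      by (simp add: case_prod_beta Let_def For.IH)
  qed simp
  then show ?case
    by (simp del: upt_Suc)
qed (simp_all add: case_prod_beta Let_def)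

text \<open>Seven loops at 40 each give 280; loop setup and the four assignments outside loops cost
  at most \<open>18 + 2 * R\<close>, absorbed by the remaining 20.\<close>

lemma kshell_ops_le:
  assumes "n \<ge> 1"
    and "oram_ops M n \<le> R" "oram_ops M (n + 1) \<le> R" "oram_ops M (m + 1) \<le> R"
  shows "kshell_ops M n m s \<le> 300 * ((n + m) * (R + 1)) + sort_ops M n"
proof -
  \<comment> \<open>The constant 40 leaves slack: the costliest body, \<open>kshell_step\<close>,
    makes 18 accesses and 17 other operations.\<close>
  have loop: "com_ops M sz (For x a b c) \<le> 2 + 40 * ((n + m) * (R + 1))"
    if "com_ops M sz c + 3 \<le> 40 * (R + 1)" "b + 1 - a \<le> n + m" for sz x a b c
    using mult_le_mono[OF that(2,1)] by (simp add: algebra_simps)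
  let ?ops = "com_ops M (kshell_size n m)" and ?Q = "40 * ((n + m) * (R + 1))"
  have "R + 1 \<le> (n + m) * (R + 1)"
    using mult_le_mono1[of 1 "n + m" "R + 1"] assms(1) by simp
  moreover have "?ops (kshell_init n) \<le> 6 + 3 * ?Q"
  proof -
    have "?ops (kshell_init n) \<le> (2 + ?Q) + ((2 + ?Q) + (2 + ?Q))"
      unfolding kshell_init_def com_ops.simps(4)
      using assms by (intro add_mono loop) auto
    then show ?thesis by linarith
  qed
  moreover have "?ops (kshell_degrees n) \<le> 2 + ?Q"
    unfolding kshell_degrees_def using assms by (intro loop) auto
  moreover have "?ops (kshell_bins n) \<le> 3 + ?Q"
  proof -
    have "?ops (kshell_bins n) \<le> 1 + (2 + ?Q)"
      unfolding kshell_bins_def com_ops.simps(4)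
      using assms by (intro add_mono loop) auto
    then show ?thesis by simp
  qed
  moreover have "?ops (kshell_sort n) \<le> sort_ops M n + (2 + ?Q)"
    unfolding kshell_sort_def com_ops.simps(4)
    using assms by (intro add_mono loop) auto
  moreover have "?ops (For Viter 1 (n + m - 1) kshell_step) \<le> 2 + ?Q"
    unfolding kshell_step_def using assms by (intro loop) auto
  ultimately show ?thesis
    unfolding kshell_ops_def snd_exec kshell_def com_ops.simps(1-5)
    using assms by (simp add: algebra_simps del: com_ops.simps(6))
qed

text \<open>A Landau bound holds only eventually; \<open>B\<close> sums the finitely many earlier
  values. Enlarging \<open>c\<close> alone could fail, since \<open>g\<close> may vanish there, as
  \<open>ln\<close> does at 1.\<close>

lemma bigo_sequentially_le:
  fixes f g :: "nat \<Rightarrow> real"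
  assumes "f \<in> O(g)"
  obtains c B where "c \<ge> 0" "B \<ge> 0" "\<And>N. \<bar>f N\<bar> \<le> c * \<bar>g N\<bar> + B"
proof -
  obtain c N0 where c: "c > 0" and N0: "\<And>N. N \<ge> N0 \<Longrightarrow> \<bar>f N\<bar> \<le> c * \<bar>g N\<bar>"
    using assms unfolding real_norm_def eventually_sequentially
    by (elim landau_o.bigE) (auto simp: eventually_sequentially)
  let ?B = "\<Sum>N<N0. \<bar>f N\<bar>"
  have B: "?B \<ge> 0"
    by (simp add: sum_nonneg)
  have "\<bar>f N\<bar> \<le> c * \<bar>g N\<bar> + ?B" for N
  proof (cases "N < N0")
    case True
    then have "\<bar>f N\<bar> \<le> ?B"
      by (intro member_le_sum) auto
    then show ?thesis
      using c by (simp add: add_increasing)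
  next
    case False
    then show ?thesis
      using N0[of N] B by linarith
  qed
  with c B show ?thesis
    by (intro that[of c ?B]) auto
qed

lemma edgelist_rep_card_le: "edgelist_rep n E edges idx \<Longrightarrow> card E \<le> n\<^sup>2"
  using card_mono[of "{1..n} \<times> {1..n}" E]
  by (simp add: edgelist_rep_def power2_eq_square card_cartesian_product)

text \<open>For \<open>n \<ge> 2\<close>,
  \<open>n\<^sup>2 + 1 \<le> 2 * n\<^sup>2 \<le> n ^ 3\<close>. This covers every array size of the
  protocol.\<close>

lemma ln_le_3_ln:
  assumes "n \<ge> 2" "1 \<le> N" "N \<le> n\<^sup>2 + 1"
  shows "ln (real N) \<le> 3 * ln (real n)"
proof -
  have "n\<^sup>2 + 1 \<le> 2 * n\<^sup>2"
    using assms(1) by (simp add: Suc_le_eq)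
  also have "\<dots> \<le> n ^ 3"
    using assms(1) by (simp add: power3_eq_cube power2_eq_square)
  finally have "real N \<le> real n ^ 3"
    using assms(3) by (metis le_trans of_nat_le_iff of_nat_power)
  then have "ln (real N) \<le> ln (real n ^ 3)"
    using assms by (intro ln_mono) auto
  then show ?thesis
    using assms by (simp add: ln_realpow)
qed

text \<open>The case \<open>n = 1\<close> is excluded because \<open>ln 1 = 0\<close> would make the
  bound zero while the cost is positive.\<close>

theorem corollary1:
  fixes M :: oblivious_machine
  assumes circuit_oram: "(\<lambda>N. real (oram_ops M N)) \<in> O(\<lambda>N. (ln (real N))\<^sup>2)"
    and oblivious_sort: "(\<lambda>N. real (sort_ops M N)) \<in> O(\<lambda>N. real N * (ln (real N))\<^sup>2)"
    and sorting: "sorting_function (sort_by M)"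
  shows "\<exists>C. \<forall>n E s. n \<ge> 2 \<longrightarrow> edgelist_rep n E (heap s Edges) (heap s Idx) \<longrightarrow>
           real (kshell_ops M n (card E) s) \<le> C * (real (n + card E) * (ln (real n))\<^sup>2)"
proof -
  obtain c B where c: "c \<ge> 0" "B \<ge> 0"
    and oram: "\<And>N. real (oram_ops M N) \<le> c * (ln (real N))\<^sup>2 + B"
    using bigo_sequentially_le[OF circuit_oram] by auto
  obtain d D where d: "d \<ge> 0" "D \<ge> 0"
    and sort: "\<And>N. real (sort_ops M N) \<le> d * (real N * (ln (real N))\<^sup>2) + D"
    using bigo_sequentially_le[OF oblivious_sort] by (auto simp: abs_mult)
  \<comment> \<open>The least value of the squared logarithm for \<open>n \<ge> 2\<close>; dividing
    by it turns additive constants into multiples of that square.\<close>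
  define L where "L = (ln (2 :: real))\<^sup>2"
  have L: "L > 0"
    by (simp add: L_def)
  \<comment> \<open>The 9 is the square of the factor in \<open>ln_le_3_ln\<close>.\<close>
  define A where "A = 9 * c + B / L"
  define C where "C = 300 * (A + 1 / L) + d + D / L"
  have "real (kshell_ops M n (card E) s) \<le> C * (real (n + card E) * (ln (real n))\<^sup>2)"
    if n: "n \<ge> 2" and rep: "edgelist_rep n E (heap s Edges) (heap s Idx)" for n E s
  proof -
    let ?l = "(ln (real n))\<^sup>2" and ?m = "card E"
    have Ll: "L \<le> ?l"
      unfolding L_def using n by (intro power_mono) auto
    have const: "x \<le> x / L * ?l" if "x \<ge> 0" for x
      using mult_left_mono[OF Ll that] L by (simp add: field_simps)
    have access: "real (oram_ops M N) \<le> A * ?l" if N: "1 \<le> N" "N \<le> n\<^sup>2 + 1" for N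
    proof -
      have "(ln (real N))\<^sup>2 \<le> (3 * ln (real n))\<^sup>2"
        using N ln_le_3_ln[OF n N] by (intro power_mono) auto
      then have "c * (ln (real N))\<^sup>2 \<le> c * (9 * ?l)"
        using c by (intro mult_left_mono) (auto simp: power_mult_distrib)
      then show ?thesis
        using oram[of N] const[of B] c by (simp add: A_def algebra_simps)
    qed
    \<comment> \<open>\<open>oram_ops\<close> need not be monotone, so all three sizes enter the
      maximum.\<close>
    define R where "R = Max {oram_ops M n, oram_ops M (n + 1), oram_ops M (?m + 1)}"
    have "R \<in> {oram_ops M n, oram_ops M (n + 1), oram_ops M (?m + 1)}"
      unfolding R_def by (intro Max_in) auto
    moreover have "n \<le> n\<^sup>2"
      by (simp add: power2_eq_square)
    ultimately have "real R \<le> A * ?l"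
      using edgelist_rep_card_le[OF rep] n access[of n] access[of "n + 1"] access[of "?m + 1"]
      by auto
    then have R: "real (R + 1) \<le> (A + 1 / L) * ?l"
      using const[of 1] by (simp add: algebra_simps)
    have nm: "1 \<le> real (n + ?m)" "real n \<le> real (n + ?m)"
      using n by auto
    have "kshell_ops M n ?m s \<le> 300 * ((n + ?m) * (R + 1)) + sort_ops M n"
      using n by (intro kshell_ops_le) (auto simp: R_def)
    then have "real (kshell_ops M n ?m s) \<le> 300 * (real (n + ?m) * real (R + 1)) + real (sort_ops M n)"
      by (metis (mono_tags, lifting) of_nat_add of_nat_le_iff of_nat_mult of_nat_numeral)
    also have "\<dots> \<le> 300 * (real (n + ?m) * ((A + 1 / L) * ?l)) +
                     (d * (real (n + ?m) * ?l) + D / L * (real (n + ?m) * ?l))"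
    proof (intro add_mono mult_left_mono)
      have "d * (real n * ?l) \<le> d * (real (n + ?m) * ?l)"
        using d nm by (intro mult_left_mono mult_right_mono) auto
      \<comment> \<open>The factor \<open>n + card E\<close> is at least 1, so it may be inserted
        for free.\<close>
      moreover have "D / L * ?l \<le> D / L * (real (n + ?m) * ?l)"
        using d L mult_right_mono[OF nm(1), of ?l] by (intro mult_left_mono) auto
      ultimately show "real (sort_ops M n) \<le>
          d * (real (n + ?m) * ?l) + D / L * (real (n + ?m) * ?l)"
        using sort[of n] const[of D] d by linarith
    qed (use R in auto)
    also have "\<dots> = C * (real (n + ?m) * ?l)"
      by (simp add: C_def algebra_simps add_divide_distrib)
    finally show ?thesis .
  qed
  then show ?thesis
    by blast
qed

end
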